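(* Let $(X,\|\cdot\|)$ be a Banach space, $K\subset X$ a cone with induced partial order $\preceq$. Let $r_1,r_2,R$ be positive numbers with $r_i\le R$ ($i=1,2$) and $r_1\neq r_2$, and let $T:\overline{B}(0,R)\cap K\to K$ be a mapping (not necessarily continuous) such that $T(\overline{B}(0,R)\cap K)$ is relatively compact and $$\{x\}\cap\mathbb{T}x\subset\{Tx\}\quad\text{for all }x\in\overline{B}(0,R)\cap K,$$ where $\mathbb{T}$ is the closed--convex envelope of $T$. Suppose that (i) $y\not\succeq x$ for all $y\in\mathbb{T}x$ and all $x\in K$ with $\|x\|=r_1$; (ii) $y\not\preceq x$ for all $y\in\mathbb{T}x$ and all $x\in K$ with $\|x\|=r_2$. Then $T$ has at least one fixed point $x\in K$ with $\min\{r_1,r_2\}<\|x\|<\max\{r_1,r_2\}$.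
   Context: A cone in a Banach space $X$ is a closed convex set $K$ such that $\lambda x\in K$ for all $x\in K$, $\lambda\ge 0$, and such that $x\in K$, $-x\in K$ imply $x=0$. The cone induces the partial order $x\preceq y$ iff $y-x\in K$. For $D=\overline{B}(0,R)\cap K$, the closed--convex envelope of $T:D\to K$ is $\mathbb{T}:D\to 2^K$, $\mathbb{T}x=\bigcap_{\varepsilon>0}\overline{\mathrm{co}}\,T\big(\overline{B}_\varepsilon(x)\cap D\big)$, where $\overline B_\varepsilon(x)$ is the closed ball of center $x$ and radius $\varepsilon$ and $\overline{\mathrm{co}}$ denotes closed convex hull.
   Formalization: The cone K is assumed nonempty and different from {0}; for K={0} (with T0=0) all hypotheses hold vacuously but no fixed point of positive norm exists, so the statement fails without this assumption. *)

theory Defs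
  imports "HOL-Analysis.Analysis"
begin

text \<open>A cone: closed convex set, closed under nonnegative scaling, with K \<inter> -K = {0}.
  As is standard (and necessary for the theorem), the cone is assumed nontrivial: K \<noteq> {0}.\<close>
definition cone_set :: "'a::real_normed_vector set \<Rightarrow> bool" where
  "cone_set K \<longleftrightarrow> closed K \<and> convex K \<and> K \<noteq> {} \<and> K \<noteq> {0} \<and>
     (\<forall>x\<in>K. \<forall>c::real. c \<ge> 0 \<longrightarrow> c *\<^sub>R x \<in> K) \<and>
     (\<forall>x. x \<in> K \<and> - x \<in> K \<longrightarrow> x = 0)"

definition cone_le :: "'a::real_normed_vector set \<Rightarrow> 'a \<Rightarrow> 'a \<Rightarrow> bool" where
  "cone_le K x y \<longleftrightarrow> y - x \<in> K"

definition cc_envelope :: "'a::real_normed_vector set \<Rightarrow> real \<Rightarrow> ('a \<Rightarrow> 'a) \<Rightarrow> 'a \<Rightarrow> 'a set" where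
  "cc_envelope K R T x =
     (\<Inter>\<epsilon>\<in>{0<..}. closure (convex hull (T ` (cball x \<epsilon> \<inter> (cball 0 R \<inter> K)))))"

end

theory Submission
  imports Defs
begin

text \<open>For every \<open>\<epsilon> > 0\<close> there is a continuous finite-rank map \<open>S\<close> whose value at \<open>x\<close> is within \<open>\<epsilon>\<close>
  of the convex hull of \<open>T (B\<^sub>\<epsilon>(x))\<close>. Fix \<open>0 \<noteq> e \<in> K\<close>. By Brouwer's theorem, either \<open>S\<close> has a fixed
  point in the closed annulus, or \<open>x = t S x\<close> for some \<open>t \<in> [0,1]\<close> and \<open>\<parallel>x\<parallel> = r1\<close>, or
  \<open>x = S x + l e\<close> for some \<open>l \<ge> 0\<close> and \<open>\<parallel>x\<parallel> = r2\<close>. In the compression case \<open>r2 < r1\<close> one extends \<open>S\<close>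
  to the ball of radius \<open>r2\<close> by \<open>s S (x / s) + (1 - s) e\<close> with \<open>s = \<parallel>x\<parallel> / r2\<close> and truncates the
  values radially at norm \<open>r1\<close>; the expansion case reduces to it by a radial reflection of the
  annulus. The points \<open>x\<close> so obtained are controlled by values of \<open>S\<close>, which stay near a compact
  set, so as \<open>\<epsilon> \<rightarrow> 0\<close> they accumulate at a point satisfying one of the three equations with some
  \<open>y \<in> cc_envelope K R T x\<close> in place of \<open>S x\<close>. The hypotheses (i) and (ii) exclude the two boundary alternatives.\<close>

section \<open>Arithmetic in a cone\<close>

lemma cone_set_scaleR: "cone_set K \<Longrightarrow> x \<in> K \<Longrightarrow> 0 \<le> c \<Longrightarrow> c *\<^sub>R x \<in> K"
  by (simp add: cone_set_def)

lemma cone_set_zero: "cone_set K \<Longrightarrow> 0 \<in> K"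
  using cone_set_scaleR[of K _ 0] by (auto simp: cone_set_def)

lemma cone_set_add:
  assumes "cone_set K" "x \<in> K" "y \<in> K"
  shows "x + y \<in> K"
proof -
  have "(1/2) *\<^sub>R x + (1/2) *\<^sub>R y \<in> K"
    using assms unfolding cone_set_def by (intro convexD) auto
  then have "2 *\<^sub>R ((1/2) *\<^sub>R x + (1/2) *\<^sub>R y) \<in> K"
    by (rule cone_set_scaleR[OF assms(1)]) simp
  then show ?thesis
    by (simp add: scaleR_add_right)
qed

lemma cone_set_sum:
  assumes "cone_set K" "\<And>i. i \<in> I \<Longrightarrow> f i \<in> K"
  shows "sum f I \<in> K"
  using assms(2)
  by (induction I rule: infinite_finite_induct)
    (auto intro: cone_set_zero cone_set_add assms(1))

section \<open>Brouwer's theorem for maps of finite rank\<close>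

text \<open>Each generator adds one compact segment in the sense of Minkowski sums. The
  \<open>v i\<close> may be linearly dependent, so the maps below take the point itself, not its
  coefficients, as argument.\<close>

lemma compact_bounded_combinations:
  fixes v :: "nat \<Rightarrow> 'a::real_normed_vector" and B :: real
  shows "compact {\<Sum>i<n. c i *\<^sub>R v i |c. \<forall>i<n. 0 \<le> c i \<and> c i \<le> B}" (is "compact (?Z n)")
proof (induction n)
  case 0
  then show ?case by simp
next
  case (Suc n)
  have "compact ((\<lambda>c. c *\<^sub>R v n) ` {0..B})"
    by (intro compact_continuous_image continuous_intros compact_Icc)
  with Suc have "compact {x + y |x y. x \<in> ?Z n \<and> y \<in> (\<lambda>c. c *\<^sub>R v n) ` {0..B}}"
    by (rule compact_sums)
  moreover have "{x + y |x y. x \<in> ?Z n \<and> y \<in> (\<lambda>c. c *\<^sub>R v n) ` {0..B}} = ?Z (Suc n)"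
  proof safe
    fix c :: "nat \<Rightarrow> real" and d :: real
    assume "\<forall>i<n. 0 \<le> c i \<and> c i \<le> B" "d \<in> {0..B}"
    then show "\<exists>c'. (\<Sum>i<n. c i *\<^sub>R v i) + d *\<^sub>R v n = (\<Sum>i<Suc n. c' i *\<^sub>R v i) \<and>
        (\<forall>i<Suc n. 0 \<le> c' i \<and> c' i \<le> B)"
      by (intro exI[of _ "c(n := d)"]) (auto simp: less_Suc_eq)
  next
    fix c :: "nat \<Rightarrow> real"
    assume "\<forall>i<Suc n. 0 \<le> c i \<and> c i \<le> B"
    then show "\<exists>x y. (\<Sum>i<Suc n. c i *\<^sub>R v i) = x + y \<and>
        x \<in> ?Z n \<and> y \<in> (\<lambda>c. c *\<^sub>R v n) ` {0..B}"
      by (intro exI[of _ "\<Sum>i<n. c i *\<^sub>R v i"] exI[of _ "c n *\<^sub>R v n"]) auto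
  qed
  ultimately show ?case by simp
qed

text \<open>Brouwer's theorem in coordinates. The number \<open>n\<close> of generators varies, so it is derived
  from Kuhn's combinatorial lemma rather than from the version for Euclidean space types.\<close>

lemma finite_rank_fixed_point:
  fixes v :: "nat \<Rightarrow> 'a::real_normed_vector" and g :: "nat \<Rightarrow> 'a \<Rightarrow> real"
  defines "Z \<equiv> \<lambda>n B. {\<Sum>i<n. c i *\<^sub>R v i |c. \<forall>i<n. 0 \<le> c i \<and> c i \<le> (B::real)}"
  assumes B: "0 < B"
    and cont: "\<And>i. i < n \<Longrightarrow> continuous_on (Z n B) (g i)"
    and bnd: "\<And>i x. i < n \<Longrightarrow> x \<in> Z n B \<Longrightarrow> 0 \<le> g i x \<and> g i x \<le> B"
  shows "\<exists>x\<in>Z n B. x = (\<Sum>i<n. g i x *\<^sub>R v i)"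
proof -
  \<comment> \<open>The summand 1 keeps \<open>V\<close> positive even when every \<open>v i\<close>
    vanishes or \<open>n = 0\<close>.\<close>
  define V where "V = (\<Sum>i<n. norm (v i)) + 1"
  have V: "V > 0" "(\<Sum>i<n. norm (v i)) \<le> V"
    unfolding V_def using sum_nonneg[of "{..<n}" "\<lambda>i. norm (v i)"] by auto
  have comp: "compact (Z n B)"
    unfolding Z_def by (rule compact_bounded_combinations)
  \<comment> \<open>Approximate fixed points suffice: the residual attains its minimum on the
    compact set \<open>Z n B\<close>, and that minimum must then be 0.\<close>
  have approx: "\<exists>x\<in>Z n B. norm (x - (\<Sum>i<n. g i x *\<^sub>R v i)) \<le> e" if "e > 0" for e
  proof -
    define d where "d = e / (2 * V)"
    have d: "d > 0" unfolding d_def using V that by simp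
    have small: "eventually (\<lambda>p. C / real p < r) sequentially" if "r > 0" for C r :: real
      using that tendsto_divide_0[OF tendsto_const filterlim_real_sequentially[THEN filterlim_at_top_imp_at_infinity], of C]
      by (rule order_tendstoD(2)[rotated])
    \<comment> \<open>\<open>B * V / p\<close> bounds the distance from the corner of a grid cell to
      its other vertices, so on a fine grid each \<open>g i\<close> varies by less than
      \<open>d\<close> between them.\<close>
    have "eventually (\<lambda>p. \<forall>i\<in>{..<n}. \<forall>x\<in>Z n B. \<forall>x'\<in>Z n B.
        dist x' x \<le> B * V / real p \<longrightarrow> dist (g i x') (g i x) < d) sequentially"
    proof (rule eventually_ball_finite[OF finite_lessThan], rule ballI)
      fix i assume "i \<in> {..<n}"
      then have "uniformly_continuous_on (Z n B) (g i)"
        using cont comp by (intro compact_uniformly_continuous) auto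
      then obtain r where "r > 0"
        and r: "\<forall>x\<in>Z n B. \<forall>x'\<in>Z n B. dist x' x < r \<longrightarrow> dist (g i x') (g i x) < d"
        unfolding uniformly_continuous_on_def using d by blast
      from small[OF \<open>r > 0\<close>, of "B * V"]
      show "eventually (\<lambda>p. \<forall>x\<in>Z n B. \<forall>x'\<in>Z n B.
        dist x' x \<le> B * V / real p \<longrightarrow> dist (g i x') (g i x) < d) sequentially"
        by eventually_elim (use r in force)
    qed
    moreover have "eventually (\<lambda>p. B / real p < d) sequentially"
      by (rule small[OF d])
    moreover have "eventually (\<lambda>p. p > (0::nat)) sequentially"
      by (rule eventually_gt_at_top)
    ultimately have "eventually (\<lambda>p. (\<forall>i\<in>{..<n}. \<forall>x\<in>Z n B. \<forall>x'\<in>Z n B.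
        dist x' x \<le> B * V / real p \<longrightarrow> dist (g i x') (g i x) < d) \<and> B / real p < d \<and> p > 0) sequentially"
      by (intro eventually_conj)
    then obtain p :: nat where p: "p > 0" "B / real p < d"
      and uc: "\<And>i x x'. i < n \<Longrightarrow> x \<in> Z n B \<Longrightarrow> x' \<in> Z n B \<Longrightarrow>
        dist x' x \<le> B * V / real p \<Longrightarrow> dist (g i x') (g i x) < d"
      by (auto simp: eventually_sequentially)
    define P where "P q = (\<Sum>i<n. (B / p * real (q i)) *\<^sub>R v i)" for q :: "nat \<Rightarrow> nat"
    have PZ: "P q \<in> Z n B" if "\<forall>i<n. q i \<le> p" for q
    proof -
      have "B / p * real (q i) \<le> B" if "i < n" for i
      proof -
        have "B * real (q i) \<le> B * p"
          using \<open>\<forall>i<n. q i \<le> p\<close> that B by (intro mult_left_mono) auto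
        then show ?thesis using p by (simp add: divide_simps)
      qed
      then show ?thesis
        unfolding Z_def P_def using B by (intro CollectI exI[of _ "\<lambda>i. B / p * real (q i)"]) auto
    qed
    \<comment> \<open>Label 1 says that \<open>g i\<close> does not increase coordinate
      \<open>i\<close>. The clause \<open>q i \<noteq> 0\<close> gives the label 0 that Kuhn's lemma
      requires on the lower face; on the upper face label 1 follows from
      \<open>g i \<le> B\<close>.\<close>
    define lab where "lab q i =
      (if q i \<noteq> 0 \<and> g i (P q) \<le> B / p * real (q i) then 1 else 0 :: nat)" for q :: "nat \<Rightarrow> nat" and i
    obtain q where q: "\<forall>i<n. q i < p" and
      cell: "\<forall>i<n. \<exists>r s. (\<forall>j<n. q j \<le> r j \<and> r j \<le> q j + 1) \<and>
        (\<forall>j<n. q j \<le> s j \<and> s j \<le> q j + 1) \<and> lab r i \<noteq> lab s i"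
    proof (rule kuhn_lemma[of p n lab])
      show "\<forall>x. (\<forall>i<n. x i \<le> p) \<longrightarrow> (\<forall>i<n. x i = p \<longrightarrow> lab x i = 1)"
        using p bnd PZ by (auto simp: lab_def)
    qed (use p in \<open>auto simp: lab_def\<close>)
    have qZ: "P q \<in> Z n B" using q by (intro PZ) (auto intro: less_imp_le)
    \<comment> \<open>For each \<open>i\<close> the cell has vertices with both labels, so
      \<open>g i\<close> minus the coordinate changes sign in the cell. One \<open>d\<close> pays
      for the variation of \<open>g i\<close>, the other for the mesh \<open>B / p\<close>.\<close>
    have close: "\<bar>B / p * real (q i) - g i (P q)\<bar> \<le> 2 * d" if i: "i < n" for i
    proof -
      have nbr: "dist (g i (P r)) (g i (P q)) < d" if r: "\<forall>j<n. q j \<le> r j \<and> r j \<le> q j + 1" for r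
      proof (rule uc[OF i qZ])
        have "\<forall>j<n. r j \<le> p" using r q by (metis Suc_eq_plus1 Suc_leI le_trans)
        then show "P r \<in> Z n B" by (rule PZ)
        have "dist (P r) (P q) = norm (\<Sum>j<n. (B / p * (real (r j) - real (q j))) *\<^sub>R v j)"
          by (simp add: dist_norm P_def sum_subtractf[symmetric] algebra_simps)
        also have "\<dots> \<le> (\<Sum>j<n. B / p * norm (v j))"
        proof (rule sum_norm_le)
          fix j assume "j \<in> {..<n}"
          then have "\<bar>real (r j) - real (q j)\<bar> \<le> 1" using r by fastforce
          then have "B / p * \<bar>real (r j) - real (q j)\<bar> \<le> B / p * 1"
            using B by (intro mult_left_mono) auto
          then have "\<bar>B / p * (real (r j) - real (q j))\<bar> \<le> B / p"
            using B by (simp add: abs_mult)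
          then show "norm ((B / p * (real (r j) - real (q j))) *\<^sub>R v j) \<le> B / p * norm (v j)"
            unfolding norm_scaleR by (intro mult_right_mono) auto
        qed
        also have "\<dots> = B / p * (\<Sum>j<n. norm (v j))" by (simp add: sum_distrib_left)
        also have "\<dots> \<le> B / p * V" using B V by (intro mult_left_mono) auto
        finally show "dist (P r) (P q) \<le> B * V / real p" by simp
      qed
      obtain r s where r: "\<forall>j<n. q j \<le> r j \<and> r j \<le> q j + 1" and s: "\<forall>j<n. q j \<le> s j \<and> s j \<le> q j + 1"
        and lab: "lab r i = 0" "lab s i = 1"
      proof -
        obtain r s where "\<forall>j<n. q j \<le> r j \<and> r j \<le> q j + 1" "\<forall>j<n. q j \<le> s j \<and> s j \<le> q j + 1"
          "lab r i \<noteq> lab s i" using cell i by blast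
        moreover have "lab r i = 0 \<or> lab r i = 1" "lab s i = 0 \<or> lab s i = 1"
          by (auto simp: lab_def)
        ultimately show thesis using that by metis
      qed
      have "\<forall>j<n. r j \<le> p" using r q by (metis Suc_eq_plus1 Suc_leI le_trans)
      \<comment> \<open>Label 0 may also come from \<open>r i = 0\<close>; there the inequality is
        just \<open>0 \<le> g i\<close>.\<close>
      then have "B / p * real (r i) \<le> g i (P r)"
        using lab(1) bnd[OF i PZ, of r] by (auto simp: lab_def split: if_splits)
      moreover have "B / p * real (q i) \<le> B / p * real (r i)"
        using r i B by (intro mult_left_mono) auto
      moreover have "g i (P s) \<le> B / p * real (s i)"
        using lab(2) by (auto simp: lab_def split: if_splits)
      moreover have "B / p * real (s i) \<le> B / p * (real (q i) + 1)"
        using s i B by (intro mult_left_mono) fastforce+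
      moreover have "B / p * (real (q i) + 1) = B / p * real (q i) + B / p"
        by (simp add: algebra_simps)
      ultimately show ?thesis
        using nbr[OF r] nbr[OF s] p(2) unfolding dist_real_def by linarith
    qed
    have "norm (P q - (\<Sum>i<n. g i (P q) *\<^sub>R v i)) =
        norm (\<Sum>i<n. (B / p * real (q i) - g i (P q)) *\<^sub>R v i)"
      by (simp add: P_def sum_subtractf[symmetric] scaleR_left_diff_distrib)
    also have "\<dots> \<le> (\<Sum>i<n. 2 * d * norm (v i))"
      using close by (intro sum_norm_le) (auto intro!: mult_right_mono)
    also have "\<dots> = 2 * d * (\<Sum>i<n. norm (v i))" by (simp add: sum_distrib_left)
    also have "\<dots> \<le> 2 * d * V" using d V by (intro mult_left_mono) auto
    also have "\<dots> = e" using V by (simp add: d_def)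
    finally show ?thesis using qZ by blast
  qed
  define f where "f x = norm (x - (\<Sum>i<n. g i x *\<^sub>R v i))" for x
  have small: "\<exists>x\<in>Z n B. f x \<le> d" if "0 < d" for d
    using approx[OF that] by (simp add: f_def)
  have "continuous_on (Z n B) f"
    unfolding f_def using cont by (intro continuous_intros) auto
  moreover have "Z n B \<noteq> {}" using small[of 1] by auto
  ultimately obtain x where x: "x \<in> Z n B" and min: "\<forall>y\<in>Z n B. f x \<le> f y"
    using continuous_attains_inf[OF comp] by blast
  have "f x \<le> 0 + d" if "0 < d" for d
    using small[OF that] min by force
  then have "f x \<le> 0"
    by (rule field_le_epsilon)
  then have "x = (\<Sum>i<n. g i x *\<^sub>R v i)" by (simp add: f_def)
  with x show ?thesis by blast
qed

section \<open>Compression and expansion alternatives for finite-rank maps\<close>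

text \<open>A fixed point of the extended and truncated map always exists, and its norm decides the
  alternative: below \<open>a\<close> the part that pushes along \<open>e\<close> is active, at
  \<open>b\<close> the truncation may be, and otherwise the map is \<open>S\<close> itself.\<close>

lemma finite_rank_compression:
  fixes K :: "'a::real_normed_vector set" and v :: "nat \<Rightarrow> 'a" and c :: "nat \<Rightarrow> 'a \<Rightarrow> real"
  defines "S \<equiv> \<lambda>n x. \<Sum>i<n. c i x *\<^sub>R v i"
  assumes K: "cone_set K" and ab: "0 < a" "a < b" and e: "e \<in> K" "e \<noteq> 0"
    and v: "\<And>i. i < n \<Longrightarrow> v i \<in> K"
    and cont: "\<And>i. i < n \<Longrightarrow> continuous_on {x \<in> K. a \<le> norm x \<and> norm x \<le> b} (c i)"
    and bnd: "\<And>i x. i < n \<Longrightarrow> x \<in> K \<Longrightarrow> a \<le> norm x \<Longrightarrow> norm x \<le> b \<Longrightarrow> 0 \<le> c i x \<and> c i x \<le> B"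
  shows "(\<exists>x\<in>K. a \<le> norm x \<and> norm x \<le> b \<and> x = S n x) \<or>
    (\<exists>x\<in>K. norm x = b \<and> (\<exists>t\<in>{0..1}. x = t *\<^sub>R S n x)) \<or>
    (\<exists>x\<in>K. norm x = a \<and> (\<exists>l\<ge>0. x = S n x + l *\<^sub>R e))"
proof -
  define A where "A = {x \<in> K. a \<le> norm x \<and> norm x \<le> b}"
  \<comment> \<open>\<open>q\<close> is the radial retraction of the punctured cone onto the
    annulus, \<open>s\<close> the weight that blends \<open>S\<close> with \<open>e\<close> inside
    radius \<open>a\<close>, and \<open>m\<close> the factor that truncates \<open>F\<close> at norm
    \<open>b\<close>. The coefficients \<open>g\<close> write the truncated map in the generators
    \<open>w\<close>, that is, the \<open>v i\<close> followed by \<open>e\<close>.\<close>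
  define q where "q x = (max a (min b (norm x)) / norm x) *\<^sub>R x" for x :: 'a
  define s where "s x = min 1 (norm x / a)" for x :: 'a
  define F where "F x = (\<Sum>i<n. (s x * c i (q x)) *\<^sub>R v i) + (1 - s x) *\<^sub>R e" for x
  define m where "m x = b / max b (norm (F x))" for x
  define g where "g i x = (if i < n then m x * (s x * c i (q x)) else m x * (1 - s x))" for i x
  define w where "w i = (if i < n then v i else e)" for i
  \<comment> \<open>The 1 covers the coefficient \<open>1 - s x\<close> of \<open>e\<close> and
    makes the bound positive.\<close>
  define M where "M = max 1 B"
  have F_eq: "F x = s x *\<^sub>R S n (q x) + (1 - s x) *\<^sub>R e" for x
    by (simp add: F_def S_def scaleR_sum_right)
  have s: "0 \<le> s x" "s x \<le> 1" for x using ab by (auto simp: s_def)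
  have m: "0 \<le> m x" "m x \<le> 1" for x using ab by (auto simp: m_def)
  have qA: "q x \<in> A" if "x \<in> K" "x \<noteq> 0" for x
    using that ab K by (auto simp: q_def A_def intro!: cone_set_scaleR)
  \<comment> \<open>The delicate point is 0, where \<open>q\<close> is discontinuous: there
    \<open>s\<close> tends to 0 while \<open>c i\<close> stays bounded on the annulus.\<close>
  have sc: "continuous_on K (\<lambda>x. s x * c i (q x))" if i: "i < n" for i
    unfolding continuous_on_eq_continuous_within
  proof
    fix x assume x: "x \<in> K"
    show "continuous (at x within K) (\<lambda>x. s x * c i (q x))"
    proof (cases "x = 0")
      case True
      have "((\<lambda>y. s y * M) \<longlongrightarrow> s 0 * M) (at 0 within K)"
        unfolding s_def using ab by (intro tendsto_intros) auto
      then have "((\<lambda>y. s y * M) \<longlongrightarrow> 0) (at 0 within K)" using ab by (simp add: s_def)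
      then have "((\<lambda>y. s y * c i (q y)) \<longlongrightarrow> 0) (at 0 within K)"
      proof (rule Lim_null_comparison[rotated])
        show "\<forall>\<^sub>F y in at 0 within K. norm (s y * c i (q y)) \<le> s y * M"
          unfolding eventually_at_filter
        proof (intro always_eventually allI impI)
          fix y assume "y \<noteq> 0" "y \<in> K"
          then have "0 \<le> c i (q y) \<and> c i (q y) \<le> B" using qA[of y] bnd[OF i] by (auto simp: A_def)
          then show "norm (s y * c i (q y)) \<le> s y * M"
            using s[of y] by (auto simp: abs_mult M_def intro!: mult_left_mono)
        qed
      qed
      then show ?thesis using True ab by (simp add: continuous_within s_def)
    next
      case False
      have "continuous_on (K - {0}) q"
        unfolding q_def by (intro continuous_intros) auto
      moreover have "continuous_on (q ` (K - {0})) (c i)"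
        by (rule continuous_on_subset[OF cont[OF i]]) (use qA in \<open>auto simp: A_def\<close>)
      ultimately have "continuous_on (K - {0}) (\<lambda>x. c i (q x))"
        by (intro continuous_on_compose2[of "q ` (K - {0})" "c i" "K - {0}" q]) auto
      then have "continuous_on (K - {0}) (\<lambda>x. s x * c i (q x))"
        unfolding s_def using ab by (intro continuous_intros) auto
      then have "continuous (at x within K - {0}) (\<lambda>x. s x * c i (q x))"
        using x False by (auto simp: continuous_on_eq_continuous_within)
      moreover have "at x within K - {0} = at x within K"
        using False by (intro at_within_nhd[of x "- {0}"]) auto
      ultimately show ?thesis by simp
    qed
  qed
  have scon: "continuous_on K s" unfolding s_def using ab by (intro continuous_intros) auto
  have "continuous_on K F"
    unfolding F_def
    by (intro continuous_on_add continuous_on_sum continuous_on_scaleR continuous_on_diff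
        continuous_on_const scon sc) auto
  then have mcon: "continuous_on K m" unfolding m_def using ab by (intro continuous_intros) auto
  have wK: "w i \<in> K" for i using v e by (simp add: w_def)
  let ?Z = "{\<Sum>i<Suc n. d i *\<^sub>R w i |d. \<forall>i<Suc n. 0 \<le> d i \<and> d i \<le> M}"
  have ZK: "?Z \<subseteq> K"
    using wK K by (auto intro!: cone_set_sum cone_set_add cone_set_scaleR)
  have "\<exists>x\<in>?Z. x = (\<Sum>i<Suc n. g i x *\<^sub>R w i)"
  proof (rule finite_rank_fixed_point)
    show "0 < M" by (simp add: M_def)
    fix i assume i: "i < Suc n"
    have "continuous_on K (g i)"
    proof (cases "i < n")
      case True
      then show ?thesis unfolding g_def using continuous_on_mult[OF mcon sc] by simp
    next
      case False
      then show ?thesis unfolding g_def using mcon scon by (auto intro!: continuous_intros)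
    qed
    then show "continuous_on ?Z (g i)" using ZK by (rule continuous_on_subset)
    fix x assume "x \<in> ?Z"
    then have x: "x \<in> K" using ZK by blast
    have "0 \<le> s x * c i (q x) \<and> s x * c i (q x) \<le> M" if "i < n"
    proof (cases "x = 0")
      case True then show ?thesis by (simp add: s_def M_def)
    next
      case False
      then have "0 \<le> c i (q x) \<and> c i (q x) \<le> M"
        using qA[OF x] bnd[OF that] by (force simp: A_def M_def)
      then show ?thesis using s[of x] mult_left_le_one_le[of "c i (q x)" "s x"] by auto
    qed
    moreover have "0 \<le> 1 - s x \<and> 1 - s x \<le> M" using s[of x] by (simp add: M_def)
    moreover have "0 \<le> m x * y \<and> m x * y \<le> M" if "0 \<le> y \<and> y \<le> M" for y
      using m[of x] that mult_left_le_one_le[of y "m x"] by auto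
    ultimately show "0 \<le> g i x \<and> g i x \<le> M" by (simp add: g_def)
  qed
  then obtain x where "x \<in> ?Z" and fix0: "x = (\<Sum>i<Suc n. g i x *\<^sub>R w i)" by blast
  then have x: "x \<in> K" using ZK by blast
  have "(\<Sum>i<Suc n. g i x *\<^sub>R w i) = m x *\<^sub>R F x"
    by (simp add: g_def w_def F_def scaleR_sum_right scaleR_add_right)
  with fix0 have fixm: "x = m x *\<^sub>R F x" by simp
  then have nx: "norm x = m x * norm (F x)" using m by (metis norm_scaleR abs_of_nonneg)
  have xb: "norm x \<le> b"
    unfolding nx m_def using ab by (simp add: divide_simps)
  \<comment> \<open>If the truncation were active, the norm of \<open>x\<close> would be exactly
    \<open>b\<close>.\<close>
  have m1: "m x = 1" if "norm x < b"
    using that ab unfolding nx m_def by (auto simp: max_def split: if_splits)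
  show ?thesis
  proof (cases "a \<le> norm x")
    case True
    \<comment> \<open>In the annulus the extension is \<open>S\<close>. Either the truncation is
      inactive and \<open>x\<close> is a fixed point, or \<open>x\<close> has norm \<open>b\<close>
      and \<open>t = m x\<close> works.\<close>
    have "s x = 1" "q x = x" using True xb ab by (auto simp: s_def q_def)
    then have "F x = S n x" by (simp add: F_eq)
    then show ?thesis
      using fixm m1 m[of x] True xb x by (metis atLeastAtMost_iff less_eq_real_def scaleR_one)
  next
    case False
    then have fx: "x = F x" using fixm m1 ab by simp
    \<comment> \<open>Since \<open>F\<close> takes the nonzero value \<open>e\<close> at 0, the
      weight \<open>s x\<close> is positive and the equation can be divided by it. This moves
      \<open>x\<close> radially to \<open>q x\<close> on the inner sphere, with
      \<open>l = (1 - s x) / s x\<close>.\<close>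
    have "x \<noteq> 0"
    proof
      assume "x = 0"
      then have "s x = 0" by (simp add: s_def)
      then have "F x = e" by (simp add: F_eq)
      with fx e \<open>x = 0\<close> show False by simp
    qed
    then have sx: "0 < s x" "s x = norm x / a" using False ab by (auto simp: s_def)
    have "max a (min b (norm x)) = a" using False ab by auto
    then have qx: "q x = (1 / s x) *\<^sub>R x" by (simp add: q_def sx)
    have "q x = (1 / s x) *\<^sub>R (s x *\<^sub>R S n (q x) + (1 - s x) *\<^sub>R e)"
      using fx F_eq qx by metis
    then have "q x = S n (q x) + ((1 - s x) / s x) *\<^sub>R e"
      using sx(1) by (simp add: scaleR_add_right)
    moreover have "q x \<in> K" using qA x \<open>x \<noteq> 0\<close> by (auto simp: A_def)
    moreover have "norm (q x) = a" using ab \<open>x \<noteq> 0\<close> unfolding qx sx(2) by simp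
    moreover have "0 \<le> (1 - s x) / s x" using s[of x] by simp
    ultimately show ?thesis by blast
  qed
qed

text \<open>The radial reflection \<open>z \<mapsto> k z *\<^sub>R z\<close> exchanges the two boundary spheres of the annulus, and
  conjugating with it preserves fixed points and both boundary conditions.\<close>

lemma finite_rank_expansion:
  fixes K :: "'a::real_normed_vector set" and v :: "nat \<Rightarrow> 'a" and c :: "nat \<Rightarrow> 'a \<Rightarrow> real"
  defines "S \<equiv> \<lambda>n x. \<Sum>i<n. c i x *\<^sub>R v i"
  assumes K: "cone_set K" and ab: "0 < a" "a < b" and e: "e \<in> K" "e \<noteq> 0"
    and v: "\<And>i. i < n \<Longrightarrow> v i \<in> K"
    and cont: "\<And>i. i < n \<Longrightarrow> continuous_on {x \<in> K. a \<le> norm x \<and> norm x \<le> b} (c i)"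
    and bnd: "\<And>i x. i < n \<Longrightarrow> x \<in> K \<Longrightarrow> a \<le> norm x \<Longrightarrow> norm x \<le> b \<Longrightarrow> 0 \<le> c i x \<and> c i x \<le> B"
  shows "(\<exists>x\<in>K. a \<le> norm x \<and> norm x \<le> b \<and> x = S n x) \<or>
    (\<exists>x\<in>K. norm x = a \<and> (\<exists>t\<in>{0..1}. x = t *\<^sub>R S n x)) \<or>
    (\<exists>x\<in>K. norm x = b \<and> (\<exists>l\<ge>0. x = S n x + l *\<^sub>R e))"
proof -
  define A where "A = {x \<in> K. a \<le> norm x \<and> norm x \<le> b}"
  \<comment> \<open>The factor is chosen so that \<open>z\<close> of norm \<open>\<rho>\<close> goes
    to norm \<open>a + b - \<rho>\<close> on the same ray. Dividing by \<open>k z\<close> in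
    \<open>c'\<close> is the conjugation; the lower bound \<open>a / b\<close> on \<open>k\<close>
    keeps \<open>c'\<close> bounded.\<close>
  define k where "k z = (a + b) / norm z - 1" for z :: 'a
  define c' where "c' i z = c i (k z *\<^sub>R z) / k z" for i z
  have k: "a / b \<le> k z" "0 < k z" "norm (k z *\<^sub>R z) = a + b - norm z" "k z *\<^sub>R z \<in> A" if "z \<in> A" for z
  proof -
    have z: "z \<in> K" "0 < norm z" "a \<le> norm z" "norm z \<le> b" using that ab by (auto simp: A_def)
    have "(a + b) / b \<le> (a + b) / norm z" using z ab by (intro divide_left_mono) auto
    then show 1: "a / b \<le> k z" using ab by (simp add: k_def add_divide_distrib)
    then show 2: "0 < k z" using ab by (meson divide_pos_pos less_le_trans less_trans)
    have "k z * norm z = a + b - norm z" using z by (simp add: k_def left_diff_distrib)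
    then show 3: "norm (k z *\<^sub>R z) = a + b - norm z" using 2 by simp
    show "k z *\<^sub>R z \<in> A" unfolding A_def using 2 3 z by (auto intro: cone_set_scaleR[OF K])
  qed
  have S': "k z *\<^sub>R (\<Sum>i<n. c' i z *\<^sub>R v i) = S n (k z *\<^sub>R z)" if "z \<in> A" for z
    using k(2)[OF that] by (simp add: S_def c'_def scaleR_sum_right)
  have "(\<exists>x\<in>K. a \<le> norm x \<and> norm x \<le> b \<and> x = (\<Sum>i<n. c' i x *\<^sub>R v i)) \<or>
    (\<exists>x\<in>K. norm x = b \<and> (\<exists>t\<in>{0..1}. x = t *\<^sub>R (\<Sum>i<n. c' i x *\<^sub>R v i))) \<or>
    (\<exists>x\<in>K. norm x = a \<and> (\<exists>l\<ge>0. x = (\<Sum>i<n. c' i x *\<^sub>R v i) + l *\<^sub>R e))"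
  proof (rule finite_rank_compression[OF K ab e v])
    fix i assume i: "i < n"
    have kcon: "continuous_on A k" unfolding k_def using ab by (intro continuous_intros) (auto simp: A_def)
    have "continuous_on A (\<lambda>z. c i (k z *\<^sub>R z))"
      by (rule continuous_on_compose2[OF cont[OF i]])
        (use k(4) kcon in \<open>auto simp: A_def intro!: continuous_intros\<close>)
    then have "continuous_on A (c' i)"
      unfolding c'_def using kcon by (intro continuous_intros) (auto dest!: k(2))
    then show "continuous_on {x \<in> K. a \<le> norm x \<and> norm x \<le> b} (c' i)" by (simp add: A_def)
    fix z assume "z \<in> K" "a \<le> norm z" "norm z \<le> b"
    then have z: "z \<in> A" by (simp add: A_def)
    have c: "0 \<le> c i (k z *\<^sub>R z)" "c i (k z *\<^sub>R z) \<le> B"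
      using k(4)[OF z] bnd[OF i] by (auto simp: A_def)
    then have "c' i z \<le> B / (a / b)"
      unfolding c'_def using k(1,2)[OF z] ab by (intro frac_le) auto
    then show "0 \<le> c' i z \<and> c' i z \<le> B / (a / b)"
      using c k(2)[OF z] by (simp add: c'_def)
  qed
  then show ?thesis
  proof (elim disjE bexE conjE exE)
    fix z assume "z \<in> K" "a \<le> norm z" "norm z \<le> b" and z: "z = (\<Sum>i<n. c' i z *\<^sub>R v i)"
    then have zA: "z \<in> A" by (simp add: A_def)
    have "k z *\<^sub>R z = S n (k z *\<^sub>R z)" using S'[OF zA] z by metis
    then show ?thesis using k(4)[OF zA] by (auto simp: A_def)
  next
    fix z t assume "z \<in> K" "norm z = b" and t: "t \<in> {0..1}" and z: "z = t *\<^sub>R (\<Sum>i<n. c' i z *\<^sub>R v i)"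
    then have zA: "z \<in> A" using ab by (simp add: A_def)
    have "k z *\<^sub>R z = t *\<^sub>R S n (k z *\<^sub>R z)"
      using S'[OF zA] z by (metis scaleR_left_commute)
    moreover have "norm (k z *\<^sub>R z) = a" using k(3)[OF zA] \<open>norm z = b\<close> by simp
    moreover have "k z *\<^sub>R z \<in> K" using k(4)[OF zA] by (simp add: A_def)
    ultimately show ?thesis using t by blast
  next
    fix z l assume "z \<in> K" "norm z = a" and l: "0 \<le> l" and z: "z = (\<Sum>i<n. c' i z *\<^sub>R v i) + l *\<^sub>R e"
    then have zA: "z \<in> A" using ab by (simp add: A_def)
    \<comment> \<open>Scaling by \<open>k z\<close> turns the multiple \<open>l\<close> of
      \<open>e\<close> into \<open>k z * l\<close>, still nonnegative.\<close>
    have "k z *\<^sub>R z = S n (k z *\<^sub>R z) + (k z * l) *\<^sub>R e"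
      using S'[OF zA] z by (metis scaleR_add_right scaleR_scaleR)
    moreover have "norm (k z *\<^sub>R z) = b" using k(3)[OF zA] \<open>norm z = a\<close> by simp
    moreover have "k z *\<^sub>R z \<in> K" using k(4)[OF zA] by (simp add: A_def)
    moreover have "0 \<le> k z * l" using k(2)[OF zA] l by simp
    ultimately show ?thesis by blast
  qed
qed

section \<open>Compact convex hulls and finite-rank approximation\<close>

text \<open>Mazur's theorem, by total boundedness: the hull of \<open>S\<close> lies within
  \<open>d/3\<close> of the hull of a finite net, and that hull is compact, so it has a finite net
  of its own.\<close>

lemma compact_closure_convex_hull:
  fixes S :: "'a::banach set"
  assumes "compact (closure S)"
  shows "compact (closure (convex hull S))"
  unfolding compact_eq_totally_bounded
proof (intro conjI allI impI)
  show "complete (closure (convex hull S))" by (simp add: complete_eq_closed)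
  fix d :: real assume d: "0 < d"
  have "\<exists>k. finite k \<and> closure S \<subseteq> (\<Union>x\<in>k. ball x (d/3))"
    using assms d unfolding compact_eq_totally_bounded by simp
  then obtain N where N: "finite N" "closure S \<subseteq> (\<Union>x\<in>N. ball x (d/3))" by blast
  have "compact (convex hull N)" using N by (simp add: finite_imp_compact_convex_hull)
  then have "\<exists>k. finite k \<and> convex hull N \<subseteq> (\<Union>x\<in>k. ball x (d/3))"
    using d unfolding compact_eq_totally_bounded by simp
  then obtain N' where N': "finite N'" "convex hull N \<subseteq> (\<Union>x\<in>N'. ball x (d/3))" by blast
  have "S \<subseteq> (\<Union>x\<in>convex hull N. \<Union>y\<in>ball 0 (d/3). {x + y})"
  proof
    fix s assume "s \<in> S"
    then have "s \<in> closure S" using closure_subset by (rule subsetD[rotated])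
    then obtain x where "x \<in> N" "s \<in> ball x (d/3)" using N(2) by blast
    then have "s = x + (s - x)" "x \<in> convex hull N" "s - x \<in> ball 0 (d/3)"
      by (auto simp: hull_inc dist_norm norm_minus_commute)
    then show "s \<in> (\<Union>x\<in>convex hull N. \<Union>y\<in>ball 0 (d/3). {x + y})" by blast
  qed
  \<comment> \<open>Convexity of the \<open>d/3\<close>-neighbourhood of
    \<open>convex hull N\<close> passes the inclusion from \<open>S\<close> to its convex
    hull.\<close>
  moreover have "convex (\<Union>x\<in>convex hull N. \<Union>y\<in>ball 0 (d/3). {x + y})"
    by (rule convex_sums[OF convex_convex_hull convex_ball])
  ultimately have hull: "convex hull S \<subseteq> (\<Union>x\<in>convex hull N. \<Union>y\<in>ball 0 (d/3). {x + y})"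
    by (rule hull_minimal)
  have "closure (convex hull S) \<subseteq> (\<Union>x\<in>N'. ball x d)"
  proof
    fix u assume "u \<in> closure (convex hull S)"
    then obtain u' where "u' \<in> convex hull S" "dist u' u < d/3"
      using d unfolding closure_approachable by (meson divide_pos_pos zero_less_numeral)
    moreover then obtain x y where "u' = x + y" "x \<in> convex hull N" "norm y < d/3"
      using hull by auto
    moreover then obtain z where "z \<in> N'" "dist z x < d/3" using N' by fastforce
    moreover have "dist x u' = norm y" using \<open>u' = x + y\<close> by (simp add: dist_norm)
    ultimately have "z \<in> N'" "dist z u < d"
      using dist_triangle[of z u x] dist_triangle[of x u u'] by linarith+
    then show "u \<in> (\<Union>x\<in>N'. ball x d)" by auto
  qed
  with N' show "\<exists>k. finite k \<and> closure (convex hull S) \<subseteq> (\<Union>x\<in>k. ball x d)" by blast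
qed

text \<open>\<open>T\<close> is not continuous, so the Schauder weights are smoothed out by distances to the
  preimages of small balls.\<close>

lemma finite_rank_approximation:
  fixes T :: "'a::real_normed_vector \<Rightarrow> 'a"
  assumes comp: "compact (closure (T ` D))" and d: "0 < d"
  obtains n :: nat and v :: "nat \<Rightarrow> 'a" and c :: "nat \<Rightarrow> 'a \<Rightarrow> real"
  where "\<And>i. i < n \<Longrightarrow> v i \<in> T ` D" "\<And>i. i < n \<Longrightarrow> continuous_on D (c i)"
    "\<And>i x. i < n \<Longrightarrow> x \<in> D \<Longrightarrow> 0 \<le> c i x" "\<And>x. x \<in> D \<Longrightarrow> (\<Sum>i<n. c i x) = 1"
    "\<And>x. x \<in> D \<Longrightarrow> \<exists>u\<in>convex hull (T ` (cball x d \<inter> D)). norm ((\<Sum>i<n. c i x *\<^sub>R v i) - u) \<le> d"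
proof -
  have "closure (T ` D) \<subseteq> (\<Union>y\<in>T ` D. ball y d)"
  proof
    fix x assume "x \<in> closure (T ` D)"
    then show "x \<in> (\<Union>y\<in>T ` D. ball y d)" using d unfolding closure_approachable by auto
  qed
  then obtain N where N: "N \<subseteq> T ` D" "finite N" "closure (T ` D) \<subseteq> (\<Union>y\<in>N. ball y d)"
    by (rule compactE_image[OF comp, rotated]) auto
  obtain n :: nat and v where v: "N = v ` {i. i < n}"
    using finite_imp_nat_seg_image_inj_on[OF N(2)] by blast
  \<comment> \<open>\<open>A i\<close> is the preimage of the \<open>d\<close>-ball around
    \<open>v i\<close>. The weight \<open>w i\<close> is positive exactly at distance less than
    \<open>d\<close> from it when it is nonempty, and depends continuously on \<open>x\<close>
    whatever \<open>T\<close> is.\<close>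
  define A where "A i = {z \<in> D. dist (v i) (T z) < d}" for i
  define w where "w i x = max 0 (d - infdist x (A i))" for i x
  define W where "W x = (\<Sum>i<n. w i x)" for x
  define c where "c i x = w i x / W x" for i x
  have vD: "v i \<in> T ` D" if "i < n" for i using v N that by auto
  have A0: "A i \<noteq> {}" if "i < n" for i using vD[OF that] d by (auto simp: A_def)
  have w0: "0 \<le> w i x" for i x by (simp add: w_def)
  have W: "0 < W x" if x: "x \<in> D" for x
  proof -
    have "T x \<in> (\<Union>y\<in>N. ball y d)" using x N(3) closure_subset by fast
    then obtain i where i: "i < n" "x \<in> A i" using v x by (auto simp: A_def)
    then have "0 < w i x" using d by (simp add: w_def)
    then show ?thesis unfolding W_def using i w0 by (intro sum_pos2[of _ i]) auto
  qed
  have c0: "0 \<le> c i x" if "x \<in> D" for i x using W[OF that] w0 by (simp add: c_def)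
  have c1: "(\<Sum>i<n. c i x) = 1" if "x \<in> D" for x
    using W[OF that] by (simp add: c_def W_def sum_divide_distrib[symmetric])
  show thesis
  proof (rule that[of n v c])
    fix i assume i: "i < n"
    show "v i \<in> T ` D" by (rule vD[OF i])
    have wc: "continuous_on D (w j)" for j
      unfolding w_def by (intro continuous_intros)
    have "continuous_on D W" unfolding W_def using wc by (intro continuous_intros)
    then show "continuous_on D (c i)"
      unfolding c_def using wc by (intro continuous_intros) (auto dest!: W)
    show "0 \<le> c i x" if "x \<in> D" for x by (rule c0[OF that])
  next
    fix x assume x: "x \<in> D"
    show "(\<Sum>i<n. c i x) = 1" by (rule c1[OF x])
    \<comment> \<open>A positive weight provides a point of \<open>A i\<close> within
      \<open>d\<close> of \<open>x\<close>. For zero weight any point of the ball serves, and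
      \<open>x\<close> is taken.\<close>
    have "\<exists>z. z \<in> cball x d \<inter> D \<and> norm (c i x *\<^sub>R (v i - T z)) \<le> c i x * d" if i: "i < n" for i
    proof (cases "w i x = 0")
      case True
      then show ?thesis using x d by (intro exI[of _ x]) (auto simp: c_def)
    next
      case False
      then have "infdist x (A i) < d" by (auto simp: w_def max_def split: if_splits)
      then obtain z where "z \<in> A i" "dist x z < d"
        using A0[OF i] by (auto simp: infdist_def cInf_less_iff)
      then show ?thesis using c0[OF x, of i]
        by (intro exI[of _ z]) (auto simp: A_def dist_norm intro!: mult_left_mono)
    qed
    then obtain z where z: "\<And>i. i < n \<Longrightarrow> z i \<in> cball x d \<inter> D"
      "\<And>i. i < n \<Longrightarrow> norm (c i x *\<^sub>R (v i - T (z i))) \<le> c i x * d" by metis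
    have "(\<Sum>i<n. c i x *\<^sub>R T (z i)) \<in> convex hull (T ` (cball x d \<inter> D))"
      using z(1) c0[OF x] c1[OF x] by (intro convex_sum) (auto intro: hull_inc)
    moreover have "norm ((\<Sum>i<n. c i x *\<^sub>R v i) - (\<Sum>i<n. c i x *\<^sub>R T (z i))) \<le> d"
    proof -
      have "norm ((\<Sum>i<n. c i x *\<^sub>R v i) - (\<Sum>i<n. c i x *\<^sub>R T (z i))) =
          norm (\<Sum>i<n. c i x *\<^sub>R (v i - T (z i)))"
        by (simp add: sum_subtractf scaleR_diff_right)
      also have "\<dots> \<le> (\<Sum>i<n. c i x * d)" using z(2) by (intro sum_norm_le) auto
      also have "\<dots> = d" using c1[OF x] by (simp add: sum_distrib_right[symmetric])
      finally show ?thesis .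
    qed
    ultimately show "\<exists>u\<in>convex hull (T ` (cball x d \<inter> D)). norm ((\<Sum>i<n. c i x *\<^sub>R v i) - u) \<le> d"
      by blast
  qed
qed

section \<open>Passage to the limit in the envelope\<close>

text \<open>The hull points \<open>u\<close> lie in a compact set by Mazur's theorem and the
  parameters in \<open>Q\<close>, so along a subsequence all of them converge. The norm of
  \<open>x\<close> is carried in \<open>Q\<close> because the sphere or annulus containing
  \<open>x\<close> has to survive the limit.\<close>

lemma cc_envelope_limit:
  fixes K :: "'a::banach set" and T :: "'a \<Rightarrow> 'a" and Q :: "(real \<times> real \<times> real) set"
  defines "D \<equiv> \<lambda>R. cball 0 R \<inter> K"
  assumes K: "closed K" and comp: "compact (closure (T ` D R))" and Q: "compact Q"
    and approx: "\<And>d. 0 < d \<Longrightarrow> \<exists>x\<in>D R. \<exists>u\<in>convex hull (T ` (cball x d \<inter> D R)). \<exists>t l w.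
      (t, l, norm x) \<in> Q \<and> norm (w - u) \<le> d \<and> x = t *\<^sub>R w + l *\<^sub>R e"
  shows "\<exists>x\<in>D R. \<exists>y\<in>cc_envelope K R T x. \<exists>t l. (t, l, norm x) \<in> Q \<and> x = t *\<^sub>R y + l *\<^sub>R e"
proof -
  define d where "d n = 1 / real (Suc n)" for n
  have d0: "0 < d n" for n by (simp add: d_def)
  have dlim: "d \<longlonglongrightarrow> 0" unfolding d_def using LIMSEQ_inverse_real_of_nat by (simp add: inverse_eq_divide)
  have "\<forall>n. \<exists>x u t l w. x \<in> D R \<and> u \<in> convex hull (T ` (cball x (d n) \<inter> D R)) \<and>
      (t, l, norm x) \<in> Q \<and> norm (w - u) \<le> d n \<and> x = t *\<^sub>R w + l *\<^sub>R e"
    using approx[OF d0] by blast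
  then obtain x u t l w where x: "\<And>n. x n \<in> D R"
    and u: "\<And>n. u n \<in> convex hull (T ` (cball (x n) (d n) \<inter> D R))"
    and q: "\<And>n. (t n, l n, norm (x n)) \<in> Q"
    and w: "\<And>n. norm (w n - u n) \<le> d n" and eq: "\<And>n. x n = t n *\<^sub>R w n + l n *\<^sub>R e"
    by metis
  have uC: "u n \<in> closure (convex hull (T ` D R))" for n
    using u[of n] hull_mono[of "T ` (cball (x n) (d n) \<inter> D R)" "T ` D R" convex] closure_subset by blast
  have "seq_compact (closure (convex hull (T ` D R)) \<times> Q)"
    using compact_closure_convex_hull[OF comp] Q by (intro compact_imp_seq_compact compact_Times)
  moreover have "\<forall>n. (u n, t n, l n, norm (x n)) \<in> closure (convex hull (T ` D R)) \<times> Q"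
    using uC q by simp
  ultimately obtain p r where p: "p \<in> closure (convex hull (T ` D R)) \<times> Q" and r: "strict_mono (r :: nat \<Rightarrow> nat)"
    and lim: "((\<lambda>n. (u n, t n, l n, norm (x n))) \<circ> r) \<longlonglongrightarrow> p"
    by (rule seq_compactE)
  obtain y t0 l0 m0 where p_eq: "p = (y, t0, l0, m0)" by (cases p) auto
  have ulim: "(\<lambda>n. u (r n)) \<longlonglongrightarrow> y" and tlim: "(\<lambda>n. t (r n)) \<longlonglongrightarrow> t0"
    and llim: "(\<lambda>n. l (r n)) \<longlonglongrightarrow> l0" and mlim: "(\<lambda>n. norm (x (r n))) \<longlonglongrightarrow> m0"
    using tendsto_fst[OF lim] tendsto_fst[OF tendsto_snd[OF lim]]
      tendsto_fst[OF tendsto_snd[OF tendsto_snd[OF lim]]] tendsto_snd[OF tendsto_snd[OF tendsto_snd[OF lim]]]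
    by (simp_all add: p_eq o_def)
  have drlim: "(\<lambda>n. d (r n)) \<longlonglongrightarrow> 0"
    using LIMSEQ_subseq_LIMSEQ[OF dlim r] by (simp add: o_def)
  have "(\<lambda>n. w (r n) - u (r n)) \<longlonglongrightarrow> 0"
    using w by (intro Lim_null_comparison[OF _ drlim] always_eventually) auto
  from tendsto_add[OF this ulim] have wlim: "(\<lambda>n. w (r n)) \<longlonglongrightarrow> y" by simp
  define x0 where "x0 = t0 *\<^sub>R y + l0 *\<^sub>R e"
  \<comment> \<open>No compactness of the domain is available; \<open>x\<close> converges because
    the equation expresses it through quantities that do.\<close>
  have xlim: "(\<lambda>n. x (r n)) \<longlonglongrightarrow> x0"
    unfolding x0_def by (subst eq) (intro tendsto_intros tlim wlim llim)
  have "closed (D R)" using K by (simp add: D_def closed_Int)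
  then have x0D: "x0 \<in> D R" by (rule closed_sequentially[OF _ x xlim])
  have "m0 = norm x0" using mlim tendsto_norm[OF xlim] by (rule LIMSEQ_unique)
  \<comment> \<open>Once \<open>x (r n)\<close> is within \<open>s / 2\<close> of \<open>x0\<close>
    and \<open>d (r n) < s / 2\<close>, the small ball lies in \<open>cball x0 s\<close>, so the
    tail of \<open>u\<close> stays in the closed hull for radius \<open>s\<close>.\<close>
  moreover have "y \<in> cc_envelope K R T x0"
    unfolding cc_envelope_def
  proof
    fix s :: real assume "s \<in> {0<..}"
    then have s: "0 < s / 2" by simp
    have "eventually (\<lambda>n. dist (x (r n)) x0 < s / 2) sequentially" using xlim s by (rule tendstoD)
    moreover have "eventually (\<lambda>n. d (r n) < s / 2) sequentially" using drlim s by (rule order_tendstoD)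
    ultimately have "eventually (\<lambda>n. u (r n) \<in> closure (convex hull (T ` (cball x0 s \<inter> (cball 0 R \<inter> K))))) sequentially"
    proof eventually_elim
      case (elim n)
      have "cball (x (r n)) (d (r n)) \<subseteq> cball x0 s"
        proof
        fix z assume "z \<in> cball (x (r n)) (d (r n))"
        then show "z \<in> cball x0 s"
          using elim dist_triangle[of x0 z "x (r n)"] by (simp add: dist_commute)
      qed
      then have "T ` (cball (x (r n)) (d (r n)) \<inter> D R) \<subseteq> T ` (cball x0 s \<inter> (cball 0 R \<inter> K))"
        unfolding D_def by blast
      then show ?case using u hull_mono closure_subset by (metis (no_types, lifting) subsetD)
    qed
    then show "y \<in> closure (convex hull (T ` (cball x0 s \<inter> (cball 0 R \<inter> K))))"
      by (rule Lim_in_closed_set[OF closed_closure _ _ ulim]) simp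
  qed
  ultimately show ?thesis
    using x0D p p_eq x0_def by auto
qed

section \<open>Exclusion of the boundary alternatives\<close>

theorem theorem4:
  fixes K :: "'a::banach set" and T :: "'a \<Rightarrow> 'a" and r1 r2 R :: real
  assumes "cone_set K"
    and "r1 > 0" and "r2 > 0" and "R > 0" and "r1 \<le> R" and "r2 \<le> R" and "r1 \<noteq> r2"
    and "T ` (cball 0 R \<inter> K) \<subseteq> K"
    and "compact (closure (T ` (cball 0 R \<inter> K)))"
    and "\<forall>x\<in>cball 0 R \<inter> K. {x} \<inter> cc_envelope K R T x \<subseteq> {T x}"
    and "\<forall>x\<in>K. norm x = r1 \<longrightarrow> (\<forall>y\<in>cc_envelope K R T x. \<not> cone_le K x y)"
    and "\<forall>x\<in>K. norm x = r2 \<longrightarrow> (\<forall>y\<in>cc_envelope K R T x. \<not> cone_le K y x)"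
  shows "\<exists>x\<in>K. T x = x \<and> min r1 r2 < norm x \<and> norm x < max r1 r2"
proof -
  note K = assms(1) and comp = assms(9) and i = assms(11) and ii = assms(12)
  define D where "D = cball 0 R \<inter> K"
  define a b where "a = min r1 r2" and "b = max r1 r2"
  have ab: "0 < a" "a < b" "b \<le> R" using assms(2-7) by (auto simp: a_def b_def)
  have closedK: "closed K" and convexK: "convex K" using K by (auto simp: cone_set_def)
  obtain e where e: "e \<in> K" "e \<noteq> 0" using K by (auto simp: cone_set_def)
  have "bounded (convex hull (T ` D))"
    using compact_imp_bounded[OF compact_closure_convex_hull[OF comp]] closure_subset bounded_subset
    unfolding D_def by blast
  then obtain M where M: "\<And>u. u \<in> convex hull (T ` D) \<Longrightarrow> norm u \<le> M" by (auto simp: bounded_iff)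
  \<comment> \<open>On the sphere of radius \<open>r2\<close>,
    \<open>l * norm e = norm (x - S x) \<le> R + M\<close>; this bound on \<open>l\<close> makes
    \<open>Q\<close> compact.\<close>
  define L where "L = (R + M) / norm e"
  \<comment> \<open>The three blocks encode, in order, \<open>x = t S x\<close> on the sphere of
    radius \<open>r1\<close>, \<open>x = S x + l e\<close> on the sphere of radius
    \<open>r2\<close>, and \<open>x = S x\<close> in the closed annulus.\<close>
  define Q where "Q = {0..1} \<times> {0::real} \<times> {r1} \<union> {1::real} \<times> {0..L} \<times> {r2} \<union> {1} \<times> {0} \<times> {a..b}"
  have "compact Q" unfolding Q_def by (intro compact_Un compact_Times) auto
  have approx: "\<exists>x\<in>D. \<exists>u\<in>convex hull (T ` (cball x d \<inter> D)). \<exists>t l w.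
      (t, l, norm x) \<in> Q \<and> norm (w - u) \<le> d \<and> x = t *\<^sub>R w + l *\<^sub>R e" if "0 < d" for d
  proof -
    obtain n :: nat and v :: "nat \<Rightarrow> 'a" and c :: "nat \<Rightarrow> 'a \<Rightarrow> real"
      where v: "\<And>i. i < n \<Longrightarrow> v i \<in> T ` D" and cont: "\<And>i. i < n \<Longrightarrow> continuous_on D (c i)"
        and c0: "\<And>i x. i < n \<Longrightarrow> x \<in> D \<Longrightarrow> 0 \<le> c i x" and c1: "\<And>x. x \<in> D \<Longrightarrow> (\<Sum>i<n. c i x) = 1"
        and u: "\<And>x. x \<in> D \<Longrightarrow> \<exists>u\<in>convex hull (T ` (cball x d \<inter> D)). norm ((\<Sum>i<n. c i x *\<^sub>R v i) - u) \<le> d"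
    proof (rule finite_rank_approximation[OF comp[folded D_def] \<open>0 < d\<close>], goal_cases)
      case (1 n v c)
      show thesis by (rule 1(1)[OF 1(2-6)])
    qed
    define S where "S x = (\<Sum>i<n. c i x *\<^sub>R v i)" for x
    have SM: "norm (S x) \<le> M" if "x \<in> D" for x
      unfolding S_def using v c0 c1 that by (intro M convex_sum) (auto intro: hull_inc)
    have vK: "v i \<in> K" if "i < n" for i using v[OF that] assms(8) by (auto simp: D_def)
    have AD: "{x \<in> K. a \<le> norm x \<and> norm x \<le> b} \<subseteq> D" using ab by (auto simp: D_def)
    have cont': "continuous_on {x \<in> K. a \<le> norm x \<and> norm x \<le> b} (c i)" if "i < n" for i
      using cont[OF that] AD by (rule continuous_on_subset)
    have bnd: "0 \<le> c i x \<and> c i x \<le> 1" if "i < n" "x \<in> K" "a \<le> norm x" "norm x \<le> b" for i x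
    proof -
      have xD: "x \<in> D" using AD that by blast
      have "c i x \<le> (\<Sum>j<n. c j x)" using c0[OF _ xD] that(1) by (intro member_le_sum) auto
      then show ?thesis using c0[OF that(1) xD] c1[OF xD] by simp
    qed
    have "(\<exists>x\<in>K. a \<le> norm x \<and> norm x \<le> b \<and> x = S x) \<or>
      (\<exists>x\<in>K. norm x = r1 \<and> (\<exists>t\<in>{0..1}. x = t *\<^sub>R S x)) \<or>
      (\<exists>x\<in>K. norm x = r2 \<and> (\<exists>l\<ge>0. x = S x + l *\<^sub>R e))"
    proof (cases "r1 < r2")
      case True
      then have "a = r1" "b = r2" by (auto simp: a_def b_def)
      then show ?thesis
        using finite_rank_expansion[OF K ab(1,2) e vK cont' bnd] unfolding S_def by simp
    next
      case False
      then have "a = r2" "b = r1" by (auto simp: a_def b_def)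
      then show ?thesis
        using finite_rank_compression[OF K ab(1,2) e vK cont' bnd] unfolding S_def by simp
    qed
    then obtain x t l where x: "x \<in> D" and Qx: "(t, l, norm x) \<in> Q" and eq: "x = t *\<^sub>R S x + l *\<^sub>R e"
    proof (elim disjE bexE conjE exE)
      fix x assume "x \<in> K" "a \<le> norm x" "norm x \<le> b" "x = S x"
      then show thesis using that[of x 1 0] AD by (auto simp: Q_def)
    next
      fix x t assume "x \<in> K" "norm x = r1" "t \<in> {0..1}" "x = t *\<^sub>R S x"
      then show thesis using that[of x t 0] assms(5) by (auto simp: Q_def D_def)
    next
      fix x l assume x: "x \<in> K" "norm x = r2" "0 \<le> l" "x = S x + l *\<^sub>R e"
      then have xD: "x \<in> D" using assms(6) by (auto simp: D_def)
      have "l * norm e = norm (x - S x)" using x by (metis abs_of_nonneg add_diff_cancel_left' norm_scaleR)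
      also have "\<dots> \<le> R + M" using norm_triangle_ineq4[of x "S x"] SM[OF xD] x(2) assms(6) by linarith
      finally have "l \<le> L" using e by (simp add: L_def pos_le_divide_eq)
      then show thesis using that[of x 1 l] x xD by (auto simp: Q_def)
    qed
    then show ?thesis using u[OF x] unfolding S_def by blast
  qed
  obtain x y t l where x: "x \<in> cball 0 R \<inter> K" and y: "y \<in> cc_envelope K R T x" and Qx: "(t, l, norm x) \<in> Q"
    and eq: "x = t *\<^sub>R y + l *\<^sub>R e"
    using cc_envelope_limit[OF closedK comp \<open>compact Q\<close>, of e] approx unfolding D_def by blast
  \<comment> \<open>The radius 1 is arbitrary: every set in the intersection lies in the closed
    convex set \<open>K\<close>.\<close>
  have "y \<in> closure (convex hull (T ` (cball x 1 \<inter> (cball 0 R \<inter> K))))"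
    using y by (auto simp: cc_envelope_def)
  moreover have "closure (convex hull (T ` (cball x 1 \<inter> (cball 0 R \<inter> K)))) \<subseteq> K"
    using assms(8) closedK convexK by (intro closure_minimal hull_minimal) auto
  ultimately have yK: "y \<in> K" by blast
  have xK: "x \<in> K" using x by simp
  \<comment> \<open>Here \<open>y - x = (1 - t) y\<close> is in the cone, against (i). In the other
    case \<open>x - y = l e\<close> is in the cone, against (ii).\<close>
  have not1: False if "norm x = r1" "t \<in> {0..1}" "l = 0"
  proof -
    have "y - x = (1 - t) *\<^sub>R y" using eq that by (simp add: scaleR_left_diff_distrib)
    then have "cone_le K x y" using cone_set_scaleR[OF K yK, of "1 - t"] that by (simp add: cone_le_def)
    then show False using i xK that(1) y by blast
  qed
  have not2: False if "norm x = r2" "t = 1" "0 \<le> l"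
  proof -
    have "x - y = l *\<^sub>R e" using eq that by simp
    then have "cone_le K y x" using cone_set_scaleR[OF K e(1) that(3)] by (simp add: cone_le_def)
    then show False using ii xK that(1) y by blast
  qed
  have tl: "t = 1" "l = 0" "a \<le> norm x" "norm x \<le> b"
    using Qx not1 not2 by (auto simp: Q_def)
  \<comment> \<open>The values \<open>t = 1\<close>, \<open>l = 0\<close> fall under both
    exclusions, so a fixed point on either sphere is ruled out and the inequalities become
    strict.\<close>
  then have "norm x \<noteq> r1" "norm x \<noteq> r2" using not1 not2 by auto
  then have "min r1 r2 < norm x" "norm x < max r1 r2"
    using tl(3,4) unfolding a_def b_def by linarith+
  moreover have "T x = x"
  proof -
    have "x = y" using eq tl by simp
    then have "x \<in> {x} \<inter> cc_envelope K R T x" using y by simp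
    with bspec[OF assms(10) x] have "x \<in> {T x}" by (rule subsetD)
    then show ?thesis by simp
  qed
  ultimately show ?thesis using xK by blast
qed

end
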